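(* For every $\varepsilon\in(0,1)$, every randomized $\varepsilon$-clairvoyant algorithm has competitive ratio at least $\frac{3}{2}$ for minimizing the total flow time on a single machine.
   Context: Single-machine preemptive online scheduling: jobs $j$ with release times $q_j\ge0$ and processing times $p_j>0$ arrive over time; at most one job is processed at any instant; objective total flow time $\sum_j(C_j-q_j)$. In the $\varepsilon$-clairvoyant model, $p_j$ is unknown when $j$ arrives and is revealed once the remaining processing time of $j$ is at most $\varepsilon p_j$. A randomized algorithm has competitive ratio at least $\rho$ if for every $\rho'<\rho$ there is an instance on which its expected total flow time exceeds $\rho'$ times the optimal total flow time. *)

theory Defs
  imports "HOL-Probability.Probability"
begin

record scheduling_instance =
  jobs :: "nat set"
  release :: "nat \<Rightarrow> real"
  proc_time :: "nat \<Rightarrow> real"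

definition valid_instance :: "scheduling_instance \<Rightarrow> bool" where
  "valid_instance I \<longleftrightarrow>
     finite (jobs I) \<and> (\<forall>j\<in>jobs I. 0 \<le> release I j \<and> 0 < proc_time I j)"

text \<open>The job processed at each instant, \<open>None\<close> meaning that the machine is idle.\<close>

type_synonym schedule = "real \<Rightarrow> nat option"

definition processed :: "schedule \<Rightarrow> nat \<Rightarrow> real \<Rightarrow> real" where
  "processed \<sigma> j t = measure lebesgue {s \<in> {0..t}. \<sigma> s = Some j}"

definition remaining :: "scheduling_instance \<Rightarrow> schedule \<Rightarrow> nat \<Rightarrow> real \<Rightarrow> real" where
  "remaining I \<sigma> j t = proc_time I j - processed \<sigma> j t"

definition feasible :: "scheduling_instance \<Rightarrow> schedule \<Rightarrow> bool" where
  "feasible I \<sigma> \<longleftrightarrow>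
     (\<forall>j. {t. \<sigma> t = Some j} \<in> sets lebesgue) \<and>
     (\<forall>t j. \<sigma> t = Some j \<longrightarrow> j \<in> jobs I \<and> release I j \<le> t \<and> 0 < remaining I \<sigma> j t)"

text \<open>A job that is never finished has completion time \<open>\<infinity>\<close> (the infimum of the empty set).\<close>

definition completion_time :: "scheduling_instance \<Rightarrow> schedule \<Rightarrow> nat \<Rightarrow> ennreal" where
  "completion_time I \<sigma> j = (INF t \<in> {t. 0 \<le> t \<and> remaining I \<sigma> j t \<le> 0}. ennreal t)"

definition total_flow_time :: "scheduling_instance \<Rightarrow> schedule \<Rightarrow> ennreal" where
  "total_flow_time I \<sigma> = (\<Sum>j\<in>jobs I. completion_time I \<sigma> j - ennreal (release I j))"

definition opt_flow_time :: "scheduling_instance \<Rightarrow> ennreal" where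
  "opt_flow_time I = (INF \<sigma> \<in> {\<sigma>. feasible I \<sigma>}. total_flow_time I \<sigma>)"

text \<open>
  What has become known by time \<open>t\<close> if \<open>I\<close> is processed according to \<open>\<sigma>\<close>: \<open>None\<close> for a job
  that has not arrived; otherwise its release time, together with its processing time if that
  has been revealed. The snapshot at \<open>t\<close> determines the snapshots at all earlier times.
\<close>

definition known_info ::
  "real \<Rightarrow> scheduling_instance \<Rightarrow> schedule \<Rightarrow> real \<Rightarrow> nat \<Rightarrow> (real \<times> real option) option" where
  "known_info \<epsilon> I \<sigma> t j =
     (if j \<in> jobs I \<and> release I j \<le> t
      then Some (release I j,
                 if remaining I \<sigma> j t \<le> \<epsilon> * proc_time I j then Some (proc_time I j) else None)
      else None)"

text \<open>
  A deterministic online algorithm is a map from instances to schedules whose decisions up to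
  time \<open>t\<close> depend only on what is known by time \<open>t\<close>. Both snapshots below are taken along the
  run on \<open>I\<close>. Requiring only that equal decisions before \<open>t\<close> and equal information imply an equal
  decision at \<open>t\<close> would be too weak in continuous time: two runs may differ without there being
  a first instant at which they differ.
\<close>

definition clairvoyant_algorithm ::
  "real \<Rightarrow> (scheduling_instance \<Rightarrow> schedule) \<Rightarrow> bool" where
  "clairvoyant_algorithm \<epsilon> A \<longleftrightarrow>
     (\<forall>I. valid_instance I \<longrightarrow> feasible I (A I)) \<and>
     (\<forall>I I' t. valid_instance I \<longrightarrow> valid_instance I' \<longrightarrow>
        known_info \<epsilon> I (A I) t = known_info \<epsilon> I' (A I) t \<longrightarrow>
        (\<forall>s\<in>{0..t}. A I s = A I' s))"

text \<open>
  A randomized algorithm is a random deterministic one: \<open>A \<omega>\<close> is the algorithm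
  obtained for the outcome \<open>\<omega>\<close> of the random choices.
\<close>

definition randomized_clairvoyant_algorithm ::
  "real \<Rightarrow> 'w measure \<Rightarrow> ('w \<Rightarrow> scheduling_instance \<Rightarrow> schedule) \<Rightarrow> bool" where
  "randomized_clairvoyant_algorithm \<epsilon> M A \<longleftrightarrow>
     prob_space M \<and>
     (\<forall>\<omega>\<in>space M. clairvoyant_algorithm \<epsilon> (A \<omega>)) \<and>
     (\<forall>I. valid_instance I \<longrightarrow> (\<lambda>\<omega>. total_flow_time I (A \<omega> I)) \<in> borel_measurable M)"

definition expected_flow_time ::
  "'w measure \<Rightarrow> ('w \<Rightarrow> scheduling_instance \<Rightarrow> schedule) \<Rightarrow> scheduling_instance \<Rightarrow> ennreal" where
  "expected_flow_time M A I = (\<integral>\<^sup>+ \<omega>. total_flow_time I (A \<omega> I) \<partial>M)"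

text \<open>Negative \<open>\<rho>'\<close> are truncated to \<open>0\<close> by \<open>ennreal\<close>; they add nothing when \<open>\<rho> > 0\<close>.\<close>

definition competitive_ratio_at_least ::
  "real \<Rightarrow> 'w measure \<Rightarrow> ('w \<Rightarrow> scheduling_instance \<Rightarrow> schedule) \<Rightarrow> bool" where
  "competitive_ratio_at_least \<rho> M A \<longleftrightarrow>
     (\<forall>\<rho>'<\<rho>. \<exists>I. valid_instance I \<and>
        expected_flow_time M A I > ennreal \<rho>' * opt_flow_time I)"

end

theory Submission
  imports Defs
begin

text \<open>
  Two jobs of sizes \<open>s\<close> and \<open>2 s\<close> arrive together, in an order that is a fair coin flip, and the
  phase lasts exactly \<open>s\<close>. An optimal schedule finishes the short job. The algorithm can finish it
  only if it never touches the long one, but for the first \<open>(1 - \<epsilon>) s\<close> units of work the two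
  outcomes of the coin look alike. Hence in at least one of the two outcomes a constant fraction of
  the short job is left over. Repeating this in \<open>n\<close> phases whose lengths shrink so quickly that the
  leftovers survive all later phases, the algorithm has \<open>3 n / 2\<close> unfinished jobs on average
  against \<open>n\<close>. A long stream of tiny jobs then makes these counts dominate the flow times. Since
  the \<open>2 ^ n\<close> coin sequences are averaged for each outcome of the algorithm's random choices,
  only the measurability of the total flow time is needed.
\<close>

section \<open>Work done by a feasible schedule\<close>

lemma fmeasurable_processing:
  assumes "{s. \<sigma> s = Some j} \<in> sets lebesgue" and "S \<in> lmeasurable"
  shows "{s \<in> S. \<sigma> s = Some j} \<in> lmeasurable"
proof -
  have "{s \<in> S. \<sigma> s = Some j} = S \<inter> {s. \<sigma> s = Some j}" by auto
  then show ?thesis using assms by (simp add: fmeasurable_Int_fmeasurable)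
qed

lemma processed_diff:
  assumes "feasible I \<sigma>" and "0 \<le> u" and "u \<le> t"
  shows "processed \<sigma> j t - processed \<sigma> j u = measure lebesgue {s \<in> {u<..t}. \<sigma> s = Some j}"
proof -
  have m: "{s. \<sigma> s = Some j} \<in> sets lebesgue" using assms by (simp add: feasible_def)
  have "{s \<in> {0..t}. \<sigma> s = Some j} = {s \<in> {0..u}. \<sigma> s = Some j} \<union> {s \<in> {u<..t}. \<sigma> s = Some j}"
    using assms by auto
  moreover have "measure lebesgue ({s \<in> {0..u}. \<sigma> s = Some j} \<union> {s \<in> {u<..t}. \<sigma> s = Some j})
      = measure lebesgue {s \<in> {0..u}. \<sigma> s = Some j} + measure lebesgue {s \<in> {u<..t}. \<sigma> s = Some j}"
  proof (rule measure_Un3[THEN trans])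
    show "{s \<in> {0..u}. \<sigma> s = Some j} \<in> lmeasurable" "{s \<in> {u<..t}. \<sigma> s = Some j} \<in> lmeasurable"
      by (intro fmeasurable_processing[OF m]; simp add: bounded_set_imp_lmeasurable)+
    have "{s \<in> {0..u}. \<sigma> s = Some j} \<inter> {s \<in> {u<..t}. \<sigma> s = Some j} = {}" by auto
    then show "measure lebesgue {s \<in> {0..u}. \<sigma> s = Some j} + measure lebesgue {s \<in> {u<..t}. \<sigma> s = Some j}
      - measure lebesgue ({s \<in> {0..u}. \<sigma> s = Some j} \<inter> {s \<in> {u<..t}. \<sigma> s = Some j}) =
      measure lebesgue {s \<in> {0..u}. \<sigma> s = Some j} + measure lebesgue {s \<in> {u<..t}. \<sigma> s = Some j}"
      by simp
  qed
  ultimately show ?thesis by (simp add: processed_def)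
qed

lemma processed_mono:
  assumes "feasible I \<sigma>" and "0 \<le> u" and "u \<le> t"
  shows "processed \<sigma> j u \<le> processed \<sigma> j t"
  using processed_diff[OF assms, of j] by (smt (verit) measure_nonneg)

lemma sum_processed_diff_le:
  assumes "feasible I \<sigma>" and "0 \<le> u" and "u \<le> t" and "finite J"
  shows "(\<Sum>j\<in>J. processed \<sigma> j t - processed \<sigma> j u) \<le> t - u"
proof -
  have m: "{s \<in> {u<..t}. \<sigma> s = Some j} \<in> lmeasurable" for j
    using assms(1)
    by (intro fmeasurable_processing) (simp_all add: feasible_def bounded_set_imp_lmeasurable)
  have "(\<Sum>j\<in>J. processed \<sigma> j t - processed \<sigma> j u)
      = (\<Sum>j\<in>J. measure lebesgue {s \<in> {u<..t}. \<sigma> s = Some j})"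
    using processed_diff[OF assms(1-3)] by simp
  also have "\<dots> = measure lebesgue (\<Union>j\<in>J. {s \<in> {u<..t}. \<sigma> s = Some j})"
    using assms(4) m by (intro measure_UNION'[symmetric]) (auto simp: pairwise_def disjnt_def)
  also have "\<dots> \<le> measure lebesgue {u<..t}"
  proof (rule measure_mono_fmeasurable)
    show "(\<Union>j\<in>J. {s \<in> {u<..t}. \<sigma> s = Some j}) \<in> sets lebesgue"
      using m assms(4) by (intro sets.finite_UN fmeasurableD)
  qed (auto intro: bounded_set_imp_lmeasurable)
  also have "\<dots> = t - u" using assms(3) by simp
  finally show ?thesis .
qed

lemma processed_diff_le:
  assumes "feasible I \<sigma>" and "0 \<le> u" and "u \<le> t"
  shows "processed \<sigma> j t - processed \<sigma> j u \<le> t - u"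
  using sum_processed_diff_le[OF assms, of "{j}"] by simp

text \<open>Processing is possible only from the release on, so at most the single instant
  \<open>u\<close> contributes, which is a null set.\<close>

lemma processed_before_release:
  assumes "feasible I \<sigma>" and "u \<le> release I j"
  shows "processed \<sigma> j u = 0"
proof -
  have "{s \<in> {0..u}. \<sigma> s = Some j} \<subseteq> {u}"
    using assms by (force simp: feasible_def)
  then have "{s \<in> {0..u}. \<sigma> s = Some j} = {} \<or> {s \<in> {0..u}. \<sigma> s = Some j} = {u}" by blast
  then show ?thesis unfolding processed_def by (elim disjE) (simp_all only:, simp_all)
qed

lemma processed_cong:
  assumes "\<forall>s\<in>{0..u}. \<sigma> s = \<sigma>' s"
  shows "processed \<sigma> j u = processed \<sigma>' j u"
  using assms by (auto simp: processed_def intro!: arg_cong[where f = "measure lebesgue"])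

section \<open>Lower bounds on flow times\<close>

lemma completion_time_ge:
  assumes "feasible I \<sigma>" and "0 \<le> t" and "0 < remaining I \<sigma> j t"
  shows "ennreal t \<le> completion_time I \<sigma> j"
  unfolding completion_time_def
proof (rule INF_greatest)
  fix s assume "s \<in> {s. 0 \<le> s \<and> remaining I \<sigma> j s \<le> 0}"
  then have s: "0 \<le> s" "remaining I \<sigma> j s \<le> 0" by auto
  have "t \<le> s"
  proof (rule ccontr)
    assume "\<not> t \<le> s"
    then have "processed \<sigma> j s \<le> processed \<sigma> j t" using assms s by (intro processed_mono) auto
    then show False using s assms(3) by (simp add: remaining_def)
  qed
  then show "ennreal t \<le> ennreal s" by (rule ennreal_leI)
qed

text \<open>
  The flow time is the integral over time of the number of unfinished jobs. It is bounded below by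
  a step function: a job counts for a step only if it is released by the beginning of the step and
  unfinished at its end.
\<close>

lemma flow_time_ge_sampled:
  fixes T \<delta> :: real
  assumes "feasible I \<sigma>" and "0 \<le> release I j" and "0 \<le> T" and "0 < \<delta>"
  shows "ennreal (\<delta> * card {m \<in> {..<N}. release I j \<le> T + real m * \<delta> \<and>
           0 < remaining I \<sigma> j (T + real (Suc m) * \<delta>)})
         \<le> completion_time I \<sigma> j - ennreal (release I j)"
    (is "ennreal (\<delta> * card ?S) \<le> _")
proof (cases "?S = {}")
  case True
  then have "card ?S = 0" by (simp only: card.empty)
  then show ?thesis by (simp only:) simp
next
  case False
  have fin: "finite ?S" by simp
  \<comment> \<open>With \<open>a\<close> the first and \<open>b\<close> the last counted step, at
    most \<open>b + 1 - a\<close> steps are counted. Their total length fits between the release,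
    which precedes step \<open>a\<close>, and the end of step \<open>b\<close>, when the job is
    still unfinished.\<close>
  define a b where "a = Min ?S" and "b = Max ?S"
  have a: "a \<in> ?S" unfolding a_def by (rule Min_in[OF fin False])
  have b: "b \<in> ?S" unfolding b_def by (rule Max_in[OF fin False])
  have "?S \<subseteq> {a..b}"
    using Min_le[OF fin] Max_ge[OF fin] unfolding a_def b_def by (meson atLeastAtMost_iff subsetI)
  from card_mono[OF _ this] have "card ?S \<le> Suc b - a" by simp
  moreover have "a \<le> b" unfolding a_def b_def using fin False by (meson Min_le Max_in)
  ultimately have "real (card ?S) \<le> real (Suc b) - real a" by linarith
  then have "\<delta> * card ?S \<le> \<delta> * (real (Suc b) - real a)" using assms(4) by (intro mult_left_mono) auto
  also have "\<dots> \<le> T + real (Suc b) * \<delta> - release I j" using a by (simp add: algebra_simps)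
  finally have "ennreal (\<delta> * card ?S) \<le> ennreal (T + real (Suc b) * \<delta> - release I j)"
    by (rule ennreal_leI)
  also have "\<dots> = ennreal (T + real (Suc b) * \<delta>) - ennreal (release I j)"
    using assms(2) by (rule ennreal_minus[symmetric])
  also have "\<dots> \<le> completion_time I \<sigma> j - ennreal (release I j)"
    using b assms by (intro ennreal_minus_mono completion_time_ge) auto
  finally show ?thesis .
qed

text \<open>Double counting of the pairs of a step and a job alive during it: every step contributes
  at least \<open>c\<close>, and the steps of one job bound its flow time from below.\<close>

lemma total_flow_time_ge_sampled:
  fixes T \<delta> :: real
  assumes "valid_instance I" and "feasible I \<sigma>" and "0 \<le> T" and "0 < \<delta>"
    and alive: "\<And>m. m < N \<Longrightarrow> c \<le> card {j \<in> jobs I. release I j \<le> T + real m * \<delta> \<and>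
           0 < remaining I \<sigma> j (T + real (Suc m) * \<delta>)}"
  shows "ennreal (real N * \<delta> * real c) \<le> total_flow_time I \<sigma>"
proof -
  let ?P = "\<lambda>j m. release I j \<le> T + real m * \<delta> \<and> 0 < remaining I \<sigma> j (T + real (Suc m) * \<delta>)"
  have fin: "finite (jobs I)" using assms(1) by (simp add: valid_instance_def)
  have "N * c \<le> (\<Sum>m<N. card {j \<in> jobs I. ?P j m})"
    using sum_mono[of "{..<N}" "\<lambda>_. c", OF alive] by simp
  also have "\<dots> = (\<Sum>j\<in>jobs I. card {m \<in> {..<N}. ?P j m})"
    using fin by (simp only: card_eq_sum) (rule sum.swap_restrict, auto)
  finally have "real N * real c \<le> real (\<Sum>j\<in>jobs I. card {m \<in> {..<N}. ?P j m})"
    by (simp only: of_nat_mult[symmetric] of_nat_le_iff)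
  from mult_left_mono[OF this, of \<delta>] assms(4)
  have "real N * \<delta> * real c \<le> (\<Sum>j\<in>jobs I. \<delta> * card {m \<in> {..<N}. ?P j m})"
    by (simp add: sum_distrib_left algebra_simps)
  then have "ennreal (real N * \<delta> * real c) \<le> ennreal (\<Sum>j\<in>jobs I. \<delta> * card {m \<in> {..<N}. ?P j m})"
    by (rule ennreal_leI)
  also have "\<dots> = (\<Sum>j\<in>jobs I. ennreal (\<delta> * card {m \<in> {..<N}. ?P j m}))"
    using assms(4) by (intro sum_ennreal[symmetric]) auto
  also have "\<dots> \<le> total_flow_time I \<sigma>"
    unfolding total_flow_time_def
    using assms(1-4) by (intro sum_mono flow_time_ge_sampled) (auto simp: valid_instance_def)
  finally show ?thesis .
qed

section \<open>Upper bound on the optimum by nonpreemptive schedules\<close>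

lemma opt_flow_time_le_intervals:
  fixes st :: "nat \<Rightarrow> real"
  assumes "valid_instance I"
    and released: "\<And>j. j \<in> jobs I \<Longrightarrow> release I j \<le> st j"
    and disjoint: "\<And>j k t. j \<in> jobs I \<Longrightarrow> k \<in> jobs I \<Longrightarrow> t \<in> {st j..<st j + proc_time I j} \<Longrightarrow>
           t \<in> {st k..<st k + proc_time I k} \<Longrightarrow> j = k"
  shows "opt_flow_time I \<le> ennreal (\<Sum>j\<in>jobs I. st j + proc_time I j - release I j)"
proof -
  \<comment> \<open>The intervals are half-open because feasibility forbids processing a job at an
    instant when nothing of it remains. Disjointness makes the choice by \<open>THE\<close>
    unique.\<close>
  define \<sigma> where "\<sigma> t = (if \<exists>j\<in>jobs I. t \<in> {st j..<st j + proc_time I j}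
     then Some (THE j. j \<in> jobs I \<and> t \<in> {st j..<st j + proc_time I j}) else None)" for t
  have \<sigma>_iff: "\<sigma> t = Some j \<longleftrightarrow> j \<in> jobs I \<and> t \<in> {st j..<st j + proc_time I j}" for t j
  proof (cases "\<exists>j\<in>jobs I. t \<in> {st j..<st j + proc_time I j}")
    case True
    then obtain k where k: "k \<in> jobs I" "t \<in> {st k..<st k + proc_time I k}" by blast
    have "(THE j. j \<in> jobs I \<and> t \<in> {st j..<st j + proc_time I j}) = k"
      using k disjoint by (intro the_equality) blast+
    then have "\<sigma> t = Some k" using True by (simp add: \<sigma>_def)
    then show ?thesis using k disjoint by (metis option.inject)
  next
    case False
    then show ?thesis by (auto simp: \<sigma>_def)
  qed
  have pos: "0 \<le> release I j" "0 < proc_time I j" "0 \<le> st j" if "j \<in> jobs I" for j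
    using that assms(1) released[OF that] by (auto simp: valid_instance_def)
  have proc: "processed \<sigma> j t = t - st j"
    if "j \<in> jobs I" "st j \<le> t" "t \<le> st j + proc_time I j" for j t
  proof -
    have "measure lebesgue {s \<in> {0..t}. \<sigma> s = Some j} = measure lebesgue {st j..<t}"
    proof (cases "t = st j + proc_time I j")
      case True
      then have "{s \<in> {0..t}. \<sigma> s = Some j} = {st j..<t}"
        using that pos(3)[OF that(1)] by (auto simp: \<sigma>_iff)
      then show ?thesis by simp
    next
      case False
      then have "{s \<in> {0..t}. \<sigma> s = Some j} = {st j..t}"
        using that pos(3)[OF that(1)] by (auto simp: \<sigma>_iff)
      then show ?thesis using that by simp
    qed
    then show ?thesis using that by (simp add: processed_def)
  qed
  have "feasible I \<sigma>"
    unfolding feasible_def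
  proof (intro conjI allI impI)
    fix j show "{t. \<sigma> t = Some j} \<in> sets lebesgue"
    proof (cases "j \<in> jobs I")
      case True
      then have "{t. \<sigma> t = Some j} = {st j..<st j + proc_time I j}" by (auto simp: \<sigma>_iff)
      then show ?thesis by simp
    qed (simp add: \<sigma>_iff)
  next
    fix t j assume "\<sigma> t = Some j"
    then have j: "j \<in> jobs I" "st j \<le> t" "t < st j + proc_time I j" by (auto simp: \<sigma>_iff)
    then show "j \<in> jobs I" "release I j \<le> t" "0 < remaining I \<sigma> j t"
      using released[OF j(1)] proc[of j t] by (auto simp: remaining_def)
  qed
  then have "opt_flow_time I \<le> total_flow_time I \<sigma>"
    unfolding opt_flow_time_def by (intro INF_lower) auto
  also have "\<dots> \<le> (\<Sum>j\<in>jobs I. ennreal (st j + proc_time I j - release I j))"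
    unfolding total_flow_time_def
  proof (rule sum_mono)
    fix j assume j: "j \<in> jobs I"
    have "completion_time I \<sigma> j \<le> ennreal (st j + proc_time I j)"
      unfolding completion_time_def using j pos[OF j] proc[OF j, of "st j + proc_time I j"]
      by (intro INF_lower) (auto simp: remaining_def)
    then have "completion_time I \<sigma> j - ennreal (release I j)
        \<le> ennreal (st j + proc_time I j) - ennreal (release I j)"
      by (intro ennreal_minus_mono) auto
    also have "\<dots> = ennreal (st j + proc_time I j - release I j)"
      using pos(1)[OF j] by (rule ennreal_minus)
    finally show "completion_time I \<sigma> j - ennreal (release I j)
        \<le> ennreal (st j + proc_time I j - release I j)" .
  qed
  also have "\<dots> = ennreal (\<Sum>j\<in>jobs I. st j + proc_time I j - release I j)"
    using released pos by (intro sum_ennreal) (smt (verit))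
  finally show ?thesis .
qed

section \<open>The instances of the adversary\<close>

text \<open>There are \<open>n\<close> phases, each shorter than the one before by the factor
  \<open>\<theta>\<close>, and \<open>N\<close> tiny jobs. The bound on \<open>\<theta>\<close>
  makes half of the work that can be done blindly in phase \<open>i\<close> at least
  \<open>4 * \<theta> ^ Suc i\<close>, twice the leftover required in \<open>missed\<close>.\<close>

locale adversary =
  fixes \<epsilon> \<theta> :: real and n N :: nat
  assumes theta_pos: "0 < \<theta>" and theta_le: "\<theta> \<le> (1 - \<epsilon>) / 8" and eps_pos: "0 < \<epsilon>"
begin

definition phase_start :: "nat \<Rightarrow> real" where
  "phase_start i = (\<Sum>k<i. \<theta> ^ k)"

text \<open>
  Slots \<open>k\<close> and \<open>n + k\<close> with \<open>k < n\<close> are the short and the long job of phase \<open>k\<close>, the slots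
  from \<open>2 n\<close> on are the stream. The adversary's coins are the set \<open>B\<close>: in phase \<open>k\<close> the job
  numbered \<open>k\<close> is the short one if \<open>k \<in> B\<close>, and otherwise \<open>k\<close> and \<open>n + k\<close> trade places.
\<close>

definition slot_size :: "nat \<Rightarrow> real" where
  "slot_size k = (if k < n then \<theta> ^ k else if k < 2 * n then 2 * \<theta> ^ (k - n) else \<theta> ^ n)"

definition arrival :: "nat \<Rightarrow> real" where
  "arrival k = (if k < n then phase_start k else if k < 2 * n then phase_start (k - n)
     else phase_start n + real (k - 2 * n) * \<theta> ^ n)"

definition slot :: "nat set \<Rightarrow> nat \<Rightarrow> nat" where
  "slot B j = (if j < n \<and> j \<notin> B then j + n else if n \<le> j \<and> j < 2 * n \<and> j - n \<notin> B then j - n else j)"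

text \<open>Only the processing times depend on \<open>B\<close>. The jobs \<open>k\<close> and
  \<open>n + k\<close> arrive together, so a trade of places is invisible until one of the two sizes
  is revealed.\<close>

definition inst :: "nat set \<Rightarrow> scheduling_instance" where
  "inst B = \<lparr>jobs = {..<2 * n + N}, release = arrival, proc_time = (\<lambda>j. slot_size (slot B j))\<rparr>"

lemma inst_simps [simp]:
  "jobs (inst B) = {..<2 * n + N}" "release (inst B) = arrival"
  "proc_time (inst B) j = slot_size (slot B j)"
  by (simp_all add: inst_def)

lemma theta_small: "8 * \<theta> \<le> 1"
  using theta_le eps_pos by (simp add: field_simps)

lemma phase_start_0 [simp]: "phase_start 0 = 0"
  and phase_start_Suc: "phase_start (Suc i) = phase_start i + \<theta> ^ i"
  by (simp_all add: phase_start_def)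

lemma phase_start_mono: "i \<le> k \<Longrightarrow> phase_start i \<le> phase_start k"
  using theta_pos unfolding phase_start_def by (intro sum_mono2) auto

lemma phase_start_nonneg [simp]: "0 \<le> phase_start i"
  using phase_start_mono[of 0 i] by simp

text \<open>Geometric tail. The term \<open>2 * \<theta> ^ k\<close> carries the induction, and it
  is also what survives: work of \<open>2 * \<theta> ^ i\<close> at the start of phase
  \<open>i\<close> cannot be reduced below \<open>2 * \<theta> ^ k\<close> by the start of phase
  \<open>k\<close>.\<close>

lemma phase_start_tail: "i \<le> k \<Longrightarrow> phase_start k - phase_start i + 2 * \<theta> ^ k \<le> 2 * \<theta> ^ i"
proof (induction k rule: dec_induct)
  case (step k)
  have "2 * \<theta> * \<theta> ^ k \<le> \<theta> ^ k"
    using theta_small theta_pos by simp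
  then show ?case using step by (simp add: phase_start_Suc)
qed simp

lemma phase_start_le_2: "phase_start k \<le> 2"
  using phase_start_tail[of 0 k] theta_pos by (smt (verit) le0 phase_start_0 power_0 zero_less_power)

lemma power_theta_le_1: "\<theta> ^ k \<le> 1"
  using theta_small theta_pos by (intro power_le_one) auto

lemma slot_size_pos: "0 < slot_size k"
  using theta_pos by (simp add: slot_size_def)

lemma arrival_nonneg: "0 \<le> arrival k"
  using theta_pos by (simp add: arrival_def)

lemma arrival_slot [simp]: "arrival (slot B j) = arrival j"
  by (auto simp: arrival_def slot_def)

lemma slot_slot [simp]: "slot B (slot B j) = j"
  by (auto simp: slot_def)

lemma slot_less_iff [simp]: "slot B j < 2 * n + N \<longleftrightarrow> j < 2 * n + N"
  by (auto simp: slot_def)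

lemma valid_inst: "valid_instance (inst B)"
  by (simp add: valid_instance_def slot_size_pos arrival_nonneg)

section \<open>The offline schedule\<close>

text \<open>Indexed by slots: short jobs run in their own phases, tiny jobs on arrival, and the long
  jobs back to back after the stream. Long jobs are twice as long as their phases, hence the factor
  2.\<close>

definition offline_start :: "nat \<Rightarrow> real" where
  "offline_start k = (if k < n then phase_start k
     else if k < 2 * n then phase_start n + real N * \<theta> ^ n + 2 * phase_start (k - n)
     else phase_start n + real (k - 2 * n) * \<theta> ^ n)"

lemma offline_start_short:
  assumes "k < n"
  shows "offline_start k + slot_size k \<le> phase_start n"
  using assms phase_start_mono[of "Suc k" n] by (auto simp: offline_start_def slot_size_def phase_start_Suc)

lemma offline_start_long:
  assumes "n \<le> k" "k < 2 * n"
  shows "phase_start n + real N * \<theta> ^ n \<le> offline_start k"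
  using assms by (auto simp: offline_start_def)

lemma offline_start_tiny:
  assumes "2 * n \<le> k" "k < 2 * n + N"
  shows "phase_start n \<le> offline_start k" "offline_start k + slot_size k \<le> phase_start n + real N * \<theta> ^ n"
proof -
  have "real (Suc (k - 2 * n)) * \<theta> ^ n \<le> real N * \<theta> ^ n"
    using assms theta_pos by (intro mult_right_mono) auto
  then show "phase_start n \<le> offline_start k" "offline_start k + slot_size k \<le> phase_start n + real N * \<theta> ^ n"
    using assms theta_pos by (auto simp: offline_start_def slot_size_def algebra_simps)
qed

lemma offline_start_consecutive:
  assumes "j < k" "k < n \<or> n \<le> j \<and> k < 2 * n \<or> 2 * n \<le> j"
  shows "offline_start j + slot_size j \<le> offline_start k"
proof -
  consider "k < n" | "n \<le> j" "k < 2 * n" | "2 * n \<le> j" using assms(2) by blast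
  then show ?thesis
  proof cases
    case 1
    then show ?thesis using assms(1) phase_start_mono[of "Suc j" k]
      by (simp add: offline_start_def slot_size_def phase_start_Suc)
  next
    case 2
    then have "phase_start (Suc (j - n)) \<le> phase_start (k - n)"
      using assms(1) by (intro phase_start_mono) linarith
    then show ?thesis using 2 assms(1) by (simp add: offline_start_def slot_size_def phase_start_Suc)
  next
    case 3
    have "real (Suc (j - 2 * n)) * \<theta> ^ n \<le> real (k - 2 * n) * \<theta> ^ n"
      using 3 assms theta_pos by (intro mult_right_mono) auto
    then show ?thesis using 3 assms(1) by (simp add: offline_start_def slot_size_def algebra_simps)
  qed
qed

text \<open>Slots of one kind run in the order of their indices; the three kinds occupy consecutive
  stretches of time: short, tiny, long.\<close>

lemma offline_start_separated:
  assumes "j < k" "k < 2 * n + N"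
  shows "offline_start j + slot_size j \<le> offline_start k \<or> offline_start k + slot_size k \<le> offline_start j"
proof (cases "k < n \<or> n \<le> j \<and> k < 2 * n \<or> 2 * n \<le> j")
  case True
  then show ?thesis using offline_start_consecutive assms by blast
next
  case False
  then consider "j < n" "n \<le> k" "k < 2 * n" | "j < n" "2 * n \<le> k" | "n \<le> j" "j < 2 * n" "2 * n \<le> k"
    by linarith
  then show ?thesis
  proof cases
    case 1
    have "0 \<le> real N * \<theta> ^ n" using theta_pos by simp
    then show ?thesis using 1 offline_start_short[of j] offline_start_long[of k] by linarith
  next
    case 2
    then show ?thesis using assms offline_start_short[of j] offline_start_tiny(1)[of k] by linarith
  next
    case 3
    then show ?thesis using assms offline_start_long[of j] offline_start_tiny(2)[of k] by linarith
  qed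
qed

lemma sum_slots:
  fixes f :: "nat \<Rightarrow> real"
  shows "(\<Sum>k<2 * n + N. f k) = (\<Sum>k<n. f k) + (\<Sum>k<n. f (n + k)) + (\<Sum>k<N. f (2 * n + k))"
proof -
  have split: "(\<Sum>k<a + b. f k) = (\<Sum>k<a. f k) + (\<Sum>k<b. f (a + k))" for a b
    by (induction b) (auto simp: algebra_simps)
  show ?thesis using split[of "2 * n" N] split[of n n] by (simp add: mult_2)
qed

lemma opt_inst_le:
  "opt_flow_time (inst B) \<le> ennreal ((real n + 1) * (real N * \<theta> ^ n) + 9 * real n)"
proof -
  let ?f = "\<lambda>k. offline_start k + slot_size k - arrival k"
  have "opt_flow_time (inst B)
      \<le> ennreal (\<Sum>j\<in>jobs (inst B). offline_start (slot B j) + proc_time (inst B) j - release (inst B) j)"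
  proof (rule opt_flow_time_le_intervals[OF valid_inst])
    fix j assume "j \<in> jobs (inst B)"
    have "arrival k \<le> offline_start k" for k
    proof -
      have "phase_start (k - n) \<le> phase_start n" if "k < 2 * n"
        using that by (intro phase_start_mono) simp
      moreover have "0 \<le> real N * \<theta> ^ n" using theta_pos by simp
      ultimately show ?thesis
        using phase_start_nonneg[of "k - n"] by (auto simp: arrival_def offline_start_def)
    qed
    from this[of "slot B j"] show "release (inst B) j \<le> offline_start (slot B j)" by simp
  next
    fix j k t
    assume *: "j \<in> jobs (inst B)" "k \<in> jobs (inst B)"
      "t \<in> {offline_start (slot B j)..<offline_start (slot B j) + proc_time (inst B) j}"
      "t \<in> {offline_start (slot B k)..<offline_start (slot B k) + proc_time (inst B) k}"
    then have "\<not> slot B j < slot B k" "\<not> slot B k < slot B j"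
      using offline_start_separated[of "slot B j" "slot B k"]
        offline_start_separated[of "slot B k" "slot B j"] by auto
    then have "slot B j = slot B k" by simp
    then show "j = k" by (metis slot_slot)
  qed
  also have "(\<Sum>j\<in>jobs (inst B). offline_start (slot B j) + proc_time (inst B) j - release (inst B) j)
      = (\<Sum>j<2 * n + N. ?f (slot B j))" by simp
  \<comment> \<open>\<open>slot B\<close> is an involution of the job numbers, so the cost does not
    depend on the coins.\<close>
  also have "\<dots> = (\<Sum>k<2 * n + N. ?f k)"
    by (rule sum.reindex_bij_witness[of _ "slot B" "slot B"]) auto
  also have "\<dots> = (\<Sum>k<n. ?f k) + (\<Sum>k<n. ?f (n + k)) + (\<Sum>k<N. ?f (2 * n + k))"
    by (rule sum_slots)
  \<comment> \<open>Each long job waits out the stream. The constant 8 covers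
    \<open>phase_start n\<close> (at most 2), the earlier long jobs (at most 4) and its own size (at
    most 2).\<close>
  also have "\<dots> \<le> (\<Sum>k<n. 1) + (\<Sum>k<n. real N * \<theta> ^ n + 8) + (\<Sum>k<N. \<theta> ^ n)"
  proof (intro add_mono sum_mono)
    fix k assume k: "k \<in> {..<n}"
    show "?f k \<le> 1"
      using k power_theta_le_1[of k] by (simp add: offline_start_def slot_size_def arrival_def)
    show "?f (n + k) \<le> real N * \<theta> ^ n + 8"
      using k phase_start_le_2[of k] phase_start_le_2[of n] power_theta_le_1[of k]
      by (simp add: offline_start_def slot_size_def arrival_def)
  next
    fix k assume "k \<in> {..<N}"
    show "?f (2 * n + k) \<le> \<theta> ^ n"
      by (simp add: offline_start_def slot_size_def arrival_def)
  qed
  also have "\<dots> = (real n + 1) * (real N * \<theta> ^ n) + 9 * real n"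
    by (simp add: algebra_simps)
  finally show ?thesis by (simp add: ennreal_leI)
qed

section \<open>Short jobs missed by the algorithm\<close>

definition short_job :: "nat set \<Rightarrow> nat \<Rightarrow> nat" where
  "short_job B i = (if i \<in> B then i else n + i)"

definition long_job :: "nat set \<Rightarrow> nat \<Rightarrow> nat" where
  "long_job B i = (if i \<in> B then n + i else i)"

lemma slot_size_short_job: "i < n \<Longrightarrow> slot_size (slot B (short_job B i)) = \<theta> ^ i"
  and slot_size_long_job: "i < n \<Longrightarrow> slot_size (slot B (long_job B i)) = 2 * \<theta> ^ i"
  and arrival_short_job: "i < n \<Longrightarrow> arrival (short_job B i) = phase_start i"
  and arrival_long_job: "i < n \<Longrightarrow> arrival (long_job B i) = phase_start i"
  by (auto simp: slot_size_def slot_def short_job_def long_job_def arrival_def)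

text \<open>By \<open>phase_start_tail\<close> the threshold exceeds the total length of the later
  phases by at least \<open>2 * \<theta> ^ n\<close>, so a missed short job is still unfinished when
  the stream starts.\<close>

definition missed :: "(scheduling_instance \<Rightarrow> schedule) \<Rightarrow> nat set \<Rightarrow> nat \<Rightarrow> bool" where
  "missed A B i \<longleftrightarrow>
     2 * \<theta> ^ Suc i \<le> remaining (inst B) (A (inst B)) (short_job B i) (phase_start (Suc i))"

text \<open>Flipping coin \<open>i\<close> exchanges the sizes of \<open>i\<close> and
  \<open>n + i\<close>, and both runs agree up to a time \<open>u\<close> before anything about
  these two jobs is revealed. If \<open>n + i\<close> is nearly finished where it is short, it was
  processed for most of the time from the phase start to \<open>u\<close>. Where it is long, that
  time is lost for the short job \<open>i\<close>.\<close>

lemma missed_or_missed_flipped: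
  assumes alg: "clairvoyant_algorithm \<epsilon> A" and i: "i < n" "i \<in> B"
  shows "missed A B i \<or> missed A (B - {i}) i"
proof (rule disjCI)
  let ?I = "inst B" and ?I' = "inst (B - {i})"
  let ?\<sigma> = "A ?I" and ?\<sigma>' = "A ?I'"
  \<comment> \<open>A job of size \<open>\<theta> ^ i\<close> is revealed after
    \<open>(1 - \<epsilon>) * \<theta> ^ i\<close> units of work. Half of that keeps strictly below
    the threshold.\<close>
  define \<kappa> where "\<kappa> = (1 - \<epsilon>) * \<theta> ^ i / 2"
  define u where "u = phase_start i + \<kappa>"
  have feas: "feasible ?I ?\<sigma>" "feasible ?I' ?\<sigma>'"
    using alg valid_inst by (simp_all add: clairvoyant_algorithm_def)
  have pow: "0 < \<theta> ^ i" using theta_pos by simp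
  have eps: "0 < 1 - \<epsilon>" using theta_pos theta_le by (simp add: field_simps)
  have \<kappa>: "0 < \<kappa>" "\<kappa> < (1 - \<epsilon>) * \<theta> ^ i" "\<kappa> < \<theta> ^ i" "4 * \<theta> ^ Suc i \<le> \<kappa>"
  proof -
    show "0 < \<kappa>" "\<kappa> < (1 - \<epsilon>) * \<theta> ^ i" using pow eps by (simp_all add: \<kappa>_def)
    moreover have "(1 - \<epsilon>) * \<theta> ^ i \<le> 1 * \<theta> ^ i" using pow eps_pos by (intro mult_right_mono) auto
    ultimately show "\<kappa> < \<theta> ^ i" by linarith
    show "4 * \<theta> ^ Suc i \<le> \<kappa>"
      using mult_right_mono[OF theta_le, of "\<theta> ^ i"] pow by (simp add: \<kappa>_def)
  qed
  have u: "0 \<le> phase_start i" "phase_start i \<le> u" "u < phase_start (Suc i)" "0 \<le> u"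
    using \<kappa> phase_start_nonneg[of i] by (auto simp: u_def phase_start_Suc simp del: phase_start_nonneg)
  assume "\<not> missed A (B - {i}) i"
  then have "remaining ?I' ?\<sigma>' (n + i) (phase_start (Suc i)) < 2 * \<theta> ^ Suc i"
    by (simp add: missed_def short_job_def)
  then have fast: "\<theta> ^ i - 2 * \<theta> ^ Suc i < processed ?\<sigma>' (n + i) (phase_start (Suc i))"
    using slot_size_short_job[OF i(1), of "B - {i}"] by (simp add: remaining_def short_job_def)
  \<comment> \<open>The online condition compares two instances along one run, here
    \<open>?\<sigma>'\<close>, so the claim is needed for both instances; in each of them both jobs
    have size at least \<open>\<theta> ^ i\<close>.\<close>
  have unrevealed: "\<not> remaining (inst C) ?\<sigma>' j u \<le> \<epsilon> * proc_time (inst C) j"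
    if "j = i \<or> j = n + i" for C j
  proof -
    have "processed ?\<sigma>' j (phase_start i) = 0"
      using that i by (intro processed_before_release[OF feas(2)]) (auto simp: arrival_def)
    then have "processed ?\<sigma>' j u \<le> \<kappa>"
      using processed_diff_le[OF feas(2) u(1,2), of j] by (simp add: u_def)
    moreover have "\<theta> ^ i \<le> proc_time (inst C) j"
      using that i pow by (auto simp: slot_size_def slot_def)
    then have "(1 - \<epsilon>) * \<theta> ^ i \<le> (1 - \<epsilon>) * proc_time (inst C) j"
      using eps by (intro mult_left_mono) auto
    ultimately have "processed ?\<sigma>' j u < (1 - \<epsilon>) * proc_time (inst C) j" using \<kappa>(2) by linarith
    then show ?thesis by (simp add: remaining_def algebra_simps)
  qed
  have "known_info \<epsilon> ?I' ?\<sigma>' u = known_info \<epsilon> ?I ?\<sigma>' u"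
  proof
    fix j
    show "known_info \<epsilon> ?I' ?\<sigma>' u j = known_info \<epsilon> ?I ?\<sigma>' u j"
    proof (cases "j = i \<or> j = n + i")
      case True
      then show ?thesis using unrevealed by (auto simp: known_info_def)
    next
      case False
      then have "slot (B - {i}) j = slot B j" by (auto simp: slot_def)
      then show ?thesis by (simp add: known_info_def remaining_def)
    qed
  qed
  then have "\<forall>s\<in>{0..u}. ?\<sigma>' s = ?\<sigma> s"
    using alg valid_inst by (simp add: clairvoyant_algorithm_def)
  then have same: "processed ?\<sigma>' j u = processed ?\<sigma> j u" for j by (rule processed_cong)
  \<comment> \<open>Only \<open>\<theta> ^ i - \<kappa>\<close> of the phase is left after
    \<open>u\<close>; the rest of the work on \<open>n + i\<close> belongs to the common part of the
    runs.\<close>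
  have "processed ?\<sigma>' (n + i) (phase_start (Suc i)) - processed ?\<sigma>' (n + i) u \<le> phase_start (Suc i) - u"
    using u by (intro processed_diff_le[OF feas(2)]) auto
  then have "\<kappa> - 2 * \<theta> ^ Suc i < processed ?\<sigma> (n + i) u"
    using fast same[of "n + i"] by (simp add: u_def phase_start_Suc)
  moreover have "processed ?\<sigma> (n + i) u \<le> processed ?\<sigma> (n + i) (phase_start (Suc i))"
    using u by (intro processed_mono[OF feas(1)]) auto
  moreover have "(\<Sum>j\<in>{i, n + i}. processed ?\<sigma> j (phase_start (Suc i)) - processed ?\<sigma> j (phase_start i))
      \<le> phase_start (Suc i) - phase_start i"
    using u by (intro sum_processed_diff_le[OF feas(1)]) auto
  moreover have "processed ?\<sigma> j (phase_start i) = 0" if "j = i \<or> j = n + i" for j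
    using that i by (intro processed_before_release[OF feas(1)]) (auto simp: arrival_def)
  ultimately have "processed ?\<sigma> i (phase_start (Suc i)) \<le> \<theta> ^ i - (\<kappa> - 2 * \<theta> ^ Suc i)"
    using i by (simp add: phase_start_Suc)
  then show "missed A B i"
    using i \<kappa>(4) slot_size_short_job[OF i(1), of B] by (simp add: missed_def remaining_def short_job_def)
qed

text \<open>For each \<open>i\<close>, flipping coin \<open>i\<close> pairs up the coin sets, and in
  each pair phase \<open>i\<close> is missed at least once, hence for at least half of all coin
  sets.\<close>

lemma sum_missed_ge:
  assumes alg: "clairvoyant_algorithm \<epsilon> A"
  shows "n * 2 ^ n \<le> 2 * (\<Sum>B\<in>Pow {..<n}. card {i. i < n \<and> missed A B i})"
proof -
  let ?m = "\<lambda>B i. if missed A B i then 1 else 0 :: nat"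
  define flip where "flip i B = (if i \<in> B then B - {i} else insert i B)" for i :: nat and B
  have half: "2 ^ n \<le> 2 * (\<Sum>B\<in>Pow {..<n}. ?m B i)" if "i < n" for i
  proof -
    have "(\<Sum>B\<in>Pow {..<n}. ?m (flip i B) i) = (\<Sum>B\<in>Pow {..<n}. ?m B i)"
      using that by (intro sum.reindex_bij_witness[of _ "flip i" "flip i"]) (auto simp: flip_def)
    then have "2 * (\<Sum>B\<in>Pow {..<n}. ?m B i) = (\<Sum>B\<in>Pow {..<n}. ?m B i + ?m (flip i B) i)"
      by (simp add: sum.distrib)
    moreover have "(\<Sum>B\<in>Pow {..<n}. 1) \<le> (\<Sum>B\<in>Pow {..<n}. ?m B i + ?m (flip i B) i)"
    proof (rule sum_mono)
      fix B
      show "1 \<le> ?m B i + ?m (flip i B) i"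
        using missed_or_missed_flipped[OF alg that, of B]
          missed_or_missed_flipped[OF alg that, of "insert i B"]
        by (cases "i \<in> B") (auto simp: flip_def)
    qed
    ultimately show ?thesis by (simp add: card_Pow)
  qed
  have "n * 2 ^ n = (\<Sum>i<n. 2 ^ n)" by simp
  also have "\<dots> \<le> (\<Sum>i<n. 2 * (\<Sum>B\<in>Pow {..<n}. ?m B i))" using half by (intro sum_mono) auto
  also have "\<dots> = 2 * (\<Sum>B\<in>Pow {..<n}. \<Sum>i<n. ?m B i)"
    by (subst sum.swap) (simp add: sum_distrib_left)
  also have "(\<lambda>B. \<Sum>i<n. ?m B i) = (\<lambda>B. card {i. i < n \<and> missed A B i})"
    by (auto simp: sum.If_cases intro!: arg_cong[where f = card])
  finally show ?thesis .
qed

section \<open>Unfinished jobs before and during the stream\<close>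

text \<open>Even all the time from its arrival to the stream falls short of the size of a long job
  by \<open>2 * \<theta> ^ n\<close>.\<close>

lemma remaining_long_job:
  assumes "feasible (inst B) \<sigma>" "i < n"
  shows "2 * \<theta> ^ n \<le> remaining (inst B) \<sigma> (long_job B i) (phase_start n)"
proof -
  have "processed \<sigma> (long_job B i) (phase_start i) = 0"
    using assms by (intro processed_before_release[OF assms(1)]) (simp add: arrival_long_job)
  then have "processed \<sigma> (long_job B i) (phase_start n) \<le> phase_start n - phase_start i"
    using processed_diff_le[OF assms(1), of "phase_start i" "phase_start n" "long_job B i"]
      phase_start_mono[of i n] assms(2) by simp
  then show ?thesis
    using phase_start_tail[of i n] assms(2) by (simp add: remaining_def slot_size_long_job)
qed

lemma remaining_missed_job:
  assumes "feasible (inst B) (A (inst B))" "i < n" "missed A B i"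
  shows "2 * \<theta> ^ n \<le> remaining (inst B) (A (inst B)) (short_job B i) (phase_start n)"
proof -
  have "processed (A (inst B)) (short_job B i) (phase_start n)
      - processed (A (inst B)) (short_job B i) (phase_start (Suc i)) \<le> phase_start n - phase_start (Suc i)"
    using assms phase_start_mono[of "Suc i" n] by (intro processed_diff_le) auto
  then show ?thesis
    using assms(3) phase_start_tail[of "Suc i" n] assms(2) unfolding missed_def remaining_def by linarith
qed

text \<open>All long jobs and the missed short ones count. The threshold is lowered to the size of a
  tiny job, which is all that the exchange in \<open>card_alive_ge\<close> needs.\<close>

lemma card_unfinished_ge:
  assumes "feasible (inst B) (A (inst B))"
  shows "n + card {i. i < n \<and> missed A B i}
    \<le> card {j. j < 2 * n \<and> \<theta> ^ n \<le> remaining (inst B) (A (inst B)) j (phase_start n)}"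
proof -
  have "0 < \<theta> ^ n" using theta_pos by simp
  then have sub: "long_job B ` {..<n} \<union> short_job B ` {i. i < n \<and> missed A B i}
     \<subseteq> {j. j < 2 * n \<and> \<theta> ^ n \<le> remaining (inst B) (A (inst B)) j (phase_start n)}"
    using remaining_long_job[OF assms] remaining_missed_job[of B A, OF assms]
    by (force simp: long_job_def short_job_def)
  have "inj_on (long_job B) {..<n}" "inj_on (short_job B) {i. i < n \<and> missed A B i}"
    by (auto simp: inj_on_def long_job_def short_job_def split: if_splits)
  moreover have "long_job B ` {..<n} \<inter> short_job B ` {i. i < n \<and> missed A B i} = {}"
    by (auto simp: long_job_def short_job_def split: if_splits)
  ultimately have "card (long_job B ` {..<n} \<union> short_job B ` {i. i < n \<and> missed A B i})
     = n + card {i. i < n \<and> missed A B i}"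
    by (subst card_Un_disjoint) (auto simp: card_image)
  then show ?thesis using card_mono[OF _ sub] by simp
qed

text \<open>
  The stream keeps the machine busy: each leftover job that is completed during the stream costs
  at least the size of a tiny job, so that a tiny job is left unfinished in its place.
\<close>

lemma card_alive_ge:
  assumes feas: "feasible (inst B) \<sigma>" and "m < N"
  shows "card {j. j < 2 * n \<and> \<theta> ^ n \<le> remaining (inst B) \<sigma> j (phase_start n)}
    \<le> card {j \<in> jobs (inst B). release (inst B) j \<le> phase_start n + real m * \<theta> ^ n \<and>
           0 < remaining (inst B) \<sigma> j (phase_start n + real (Suc m) * \<theta> ^ n)}"
    (is "card ?O \<le> card ?S")
proof -
  let ?T = "phase_start n" and ?U = "phase_start n + real (Suc m) * \<theta> ^ n"
  let ?rem = "remaining (inst B) \<sigma>"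
  define F where "F = {j \<in> ?O. ?rem j ?U \<le> 0}"
  \<comment> \<open>The \<open>Suc m\<close> tiny jobs released by the beginning of step
    \<open>m\<close>, with steps counted from 0.\<close>
  define tiny where "tiny = {2 * n..2 * n + m}"
  define D where "D = {j \<in> tiny. ?rem j ?U \<le> 0}"
  have pow: "0 < \<theta> ^ n" using theta_pos by simp
  have T: "0 \<le> ?T" "?T \<le> ?U" using pow by auto
  have fin: "finite ?O" "finite F" "finite tiny" "finite D" by (auto simp: F_def tiny_def D_def)
  have disj: "F \<inter> D = {}" by (auto simp: F_def D_def tiny_def)
  have work: "\<theta> ^ n \<le> processed \<sigma> j ?U - processed \<sigma> j ?T" if "j \<in> F \<union> D" for j
  proof (cases "j \<in> F")
    case True
    then show ?thesis by (simp add: F_def remaining_def)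
  next
    case False
    then have j: "2 * n \<le> j" "j \<in> D" using that by (auto simp: D_def tiny_def)
    have "processed \<sigma> j ?T = 0"
      using j pow by (intro processed_before_release[OF feas]) (auto simp: arrival_def)
    then show ?thesis using j by (auto simp: D_def remaining_def slot_def slot_size_def)
  qed
  \<comment> \<open>Each job in \<open>F \<union> D\<close> takes at least
    \<open>\<theta> ^ n\<close> of the time \<open>Suc m * \<theta> ^ n\<close> up to
    \<open>?U\<close>. Hence \<open>card F\<close> is at most the number of unfinished jobs in
    \<open>tiny\<close>.\<close>
  have "real (card F + card D) * \<theta> ^ n = (\<Sum>j\<in>F \<union> D. \<theta> ^ n)"
    using fin disj by (simp add: card_Un_disjoint)
  also have "\<dots> \<le> (\<Sum>j\<in>F \<union> D. processed \<sigma> j ?U - processed \<sigma> j ?T)"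
    using work by (intro sum_mono) auto
  also have "\<dots> \<le> real (Suc m) * \<theta> ^ n"
    using sum_processed_diff_le[OF feas T, of "F \<union> D"] fin by simp
  finally have "card F + card D \<le> Suc m" using pow by (simp only: mult_le_cancel_right_pos of_nat_le_iff)
  moreover have "card (tiny - D) = Suc m - card D"
    using fin by (subst card_Diff_subset) (auto simp: D_def tiny_def)
  moreover have "card (?O - F) = card ?O - card F"
    using fin by (subst card_Diff_subset) (auto simp: F_def)
  ultimately have "card ?O \<le> card (?O - F) + card (tiny - D)" by linarith
  also have "\<dots> = card ((?O - F) \<union> (tiny - D))"
    using fin by (intro card_Un_disjoint[symmetric]) (auto simp: tiny_def)
  also have "\<dots> \<le> card ?S"
  proof (rule card_mono)
    have "?rem j ?U > 0" "j < 2 * n + N" "arrival j \<le> ?T + real m * \<theta> ^ n" if "j \<in> ?O - F" for j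
    proof -
      show "?rem j ?U > 0" "j < 2 * n + N" using that by (auto simp: F_def)
      have "arrival j \<le> ?T" using that phase_start_mono[of j n] phase_start_mono[of "j - n" n]
        by (auto simp: arrival_def)
      then show "arrival j \<le> ?T + real m * \<theta> ^ n" using pow by (smt (verit) mult_nonneg_nonneg of_nat_0_le_iff)
    qed
    moreover have "?rem j ?U > 0" "j < 2 * n + N" "arrival j \<le> ?T + real m * \<theta> ^ n" if "j \<in> tiny - D" for j
    proof -
      show "?rem j ?U > 0" "j < 2 * n + N" using that \<open>m < N\<close> by (auto simp: D_def tiny_def)
      show "arrival j \<le> ?T + real m * \<theta> ^ n" using that pow by (auto simp: arrival_def tiny_def)
    qed
    ultimately show "(?O - F) \<union> (tiny - D) \<subseteq> ?S" by auto
  qed simp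
  finally show ?thesis .
qed

section \<open>Averaging over the coins\<close>

lemma sum_flow_time_ge:
  assumes alg: "clairvoyant_algorithm \<epsilon> A"
  shows "ennreal (2 ^ n * (3 / 2 * real n * (real N * \<theta> ^ n)))
    \<le> (\<Sum>B\<in>Pow {..<n}. total_flow_time (inst B) (A (inst B)))"
proof -
  let ?c = "\<lambda>B. n + card {i. i < n \<and> missed A B i}"
  have pow: "0 < \<theta> ^ n" using theta_pos by simp
  have "n * 2 ^ n + 2 * (n * 2 ^ n) \<le> 2 * (\<Sum>B\<in>Pow {..<n}. ?c B)"
    using sum_missed_ge[OF alg] by (simp add: sum.distrib card_Pow)
  then have "real (n * 2 ^ n + 2 * (n * 2 ^ n)) \<le> real (2 * (\<Sum>B\<in>Pow {..<n}. ?c B))"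
    by (simp only: of_nat_le_iff)
  then have "3 / 2 * real n * 2 ^ n \<le> real (\<Sum>B\<in>Pow {..<n}. ?c B)" by simp
  from mult_left_mono[OF this, of "real N * \<theta> ^ n"]
  have "2 ^ n * (3 / 2 * real n * (real N * \<theta> ^ n)) \<le> (\<Sum>B\<in>Pow {..<n}. real N * \<theta> ^ n * real (?c B))"
    using pow by (simp add: sum_distrib_left algebra_simps)
  then have "ennreal (2 ^ n * (3 / 2 * real n * (real N * \<theta> ^ n)))
      \<le> ennreal (\<Sum>B\<in>Pow {..<n}. real N * \<theta> ^ n * real (?c B))" by (rule ennreal_leI)
  also have "\<dots> = (\<Sum>B\<in>Pow {..<n}. ennreal (real N * \<theta> ^ n * real (?c B)))"
    using pow by (intro sum_ennreal[symmetric]) simp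
  also have "\<dots> \<le> (\<Sum>B\<in>Pow {..<n}. total_flow_time (inst B) (A (inst B)))"
  proof (rule sum_mono)
    fix B
    have feas: "feasible (inst B) (A (inst B))"
      using alg valid_inst by (simp add: clairvoyant_algorithm_def)
    show "ennreal (real N * \<theta> ^ n * real (?c B)) \<le> total_flow_time (inst B) (A (inst B))"
      by (rule total_flow_time_ge_sampled[OF valid_inst feas phase_start_nonneg pow])
        (rule order_trans[OF card_unfinished_ge[of B A, OF feas] card_alive_ge[OF feas]])
  qed
  finally show ?thesis .
qed

end

section \<open>Choice of the parameters and conclusion\<close>

theorem theorem6p6:
  fixes \<epsilon> :: real
    and M :: "'w measure"
    and A :: "'w \<Rightarrow> scheduling_instance \<Rightarrow> schedule"
  assumes "0 < \<epsilon>" and "\<epsilon> < 1"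
    and "randomized_clairvoyant_algorithm \<epsilon> M A"
  shows "competitive_ratio_at_least (3 / 2) M A"
  unfolding competitive_ratio_at_least_def
proof (intro allI impI)
  fix \<rho>' :: real assume "\<rho>' < 3 / 2"
  define r where "r = max 0 \<rho>'"
  have r: "0 \<le> r" "r < 3 / 2" "ennreal \<rho>' = ennreal r"
    using \<open>\<rho>' < 3 / 2\<close> by (auto simp: r_def max_def ennreal_neg)
  define \<theta> where "\<theta> = (1 - \<epsilon>) / 8"
  have \<theta>: "0 < \<theta>" using assms by (simp add: \<theta>_def)
  \<comment> \<open>When the stream dominates, the costs compare like \<open>3 / 2 * n\<close> to
    \<open>n + 1\<close>; this \<open>n\<close> brings the ratio above \<open>r\<close>.\<close>
  obtain n :: nat where "r / (3 / 2 - r) < real n" using reals_Archimedean2 by blast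
  then have n: "r * (real n + 1) < 3 / 2 * real n" using r by (simp add: field_simps)
  define gap where "gap = (3 / 2 * real n - r * (real n + 1)) * \<theta> ^ n"
  have gap: "0 < gap" using n \<theta> by (simp add: gap_def)
  \<comment> \<open>Each tiny job contributes \<open>gap\<close> to the advantage; \<open>N\<close>
    of them outweigh \<open>r\<close> times the cost \<open>9 * n\<close>, which does not grow with
    the stream.\<close>
  obtain N :: nat where "r * (9 * real n) / gap < real N" using reals_Archimedean2 by blast
  then have "r * (9 * real n) < real N * gap" using gap by (simp add: field_simps)
  then have rN: "r * ((real n + 1) * (real N * \<theta> ^ n) + 9 * real n) < 3 / 2 * real n * (real N * \<theta> ^ n)"
    by (simp add: gap_def algebra_simps)
  interpret adversary \<epsilon> \<theta> n N using assms \<theta> by unfold_locales (auto simp: \<theta>_def)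
  interpret prob_space M using assms by (simp add: randomized_clairvoyant_algorithm_def)
  let ?opt = "(real n + 1) * (real N * \<theta> ^ n) + 9 * real n"
  show "\<exists>I. valid_instance I \<and> expected_flow_time M A I > ennreal \<rho>' * opt_flow_time I"
  \<comment> \<open>If every \<open>inst B\<close> obeyed the bound, adding over the
    \<open>2 ^ n\<close> coin sets would contradict \<open>sum_flow_time_ge\<close> integrated over
    the random choices.\<close>
  proof (rule ccontr)
    assume "\<not> ?thesis"
    then have *: "expected_flow_time M A (inst B) \<le> ennreal \<rho>' * opt_flow_time (inst B)" for B
      using valid_inst not_le by blast
    have "ennreal (2 ^ n * (3 / 2 * real n * (real N * \<theta> ^ n)))
        = (\<integral>\<^sup>+ \<omega>. ennreal (2 ^ n * (3 / 2 * real n * (real N * \<theta> ^ n))) \<partial>M)"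
      by (simp add: emeasure_space_1)
    also have "\<dots> \<le> (\<integral>\<^sup>+ \<omega>. (\<Sum>B\<in>Pow {..<n}. total_flow_time (inst B) (A \<omega> (inst B))) \<partial>M)"
      using assms by (intro nn_integral_mono sum_flow_time_ge)
        (simp add: randomized_clairvoyant_algorithm_def)
    also have "\<dots> = (\<Sum>B\<in>Pow {..<n}. expected_flow_time M A (inst B))"
      unfolding expected_flow_time_def using assms valid_inst
      by (intro nn_integral_sum) (simp add: randomized_clairvoyant_algorithm_def)
    also have "\<dots> \<le> (\<Sum>B\<in>Pow {..<n}. ennreal r * ennreal ?opt)"
      using * opt_inst_le r(3) by (intro sum_mono) (metis (no_types, lifting) mult_left_mono order_trans zero_le)
    also have "\<dots> = ennreal (2 ^ n) * ennreal (r * ?opt)"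
      using r by (simp add: card_Pow ennreal_mult' ennreal_power flip: ennreal_numeral)
    also have "\<dots> = ennreal (2 ^ n * (r * ?opt))" by (simp add: ennreal_mult')
    also have "\<dots> < ennreal (2 ^ n * (3 / 2 * real n * (real N * \<theta> ^ n)))"
    proof (rule ennreal_lessI)
      have "0 \<le> r * ?opt" using r \<theta> by simp
      then have "0 < 3 / 2 * real n * (real N * \<theta> ^ n)" using rN by linarith
      then show "0 < 2 ^ n * (3 / 2 * real n * (real N * \<theta> ^ n))" by (rule mult_pos_pos[rotated]) simp
    qed (rule mult_strict_left_mono[OF rN], simp)
    finally show False by simp
  qed
qed

end
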